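(* Let $(\gamma,\nu):I\to\mathbb{R}^2\times S^1$ be a Legendre curve with curvature $(\ell,\beta)$, and write $\gamma(t)=(x(t),z(t))$, $\nu(t)=(a(t),b(t))$. Let $\boldsymbol{z}:I\times[0,2\pi)\to\mathbb{R}^3$, $\boldsymbol{z}(t,\theta)=(x(t)\cos\theta,x(t)\sin\theta,z(t))$, be the surface of revolution of $\gamma$ around the $z$-axis, and put $$\boldsymbol{n}^z(t,\theta)=(a(t)\cos\theta,a(t)\sin\theta,b(t)),\qquad \boldsymbol{s}^z(t,\theta)=(\sin\theta,-\cos\theta,0).$$ Then $(\boldsymbol{z},\boldsymbol{n}^z,\boldsymbol{s}^z):I\times[0,2\pi)\to\mathbb{R}^3\times\Delta$ is a framed surface with basic invariants $$\mathcal{G}^z=\begin{pmatrix}0&-\beta(t)\\ -x(t)&0\end{pmatrix},\quad \mathcal{F}^z_1=\begin{pmatrix}0&0&-\ell(t)\\ 0&0&0\\ \ell(t)&0&0\end{pmatrix},\quad \mathcal{F}^z_2=\begin{pmatrix}0&-a(t)&0\\ a(t)&0&b(t)\\ 0&-b(t)&0\end{pmatrix}.$$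
   Context: All maps are $C^\infty$; $I\subset\mathbb{R}$ is an interval and $S^1\subset\mathbb R^2$ is the unit circle. A Legendre curve is a smooth map $(\gamma,\nu):I\to\mathbb{R}^2\times S^1$ with $\dot\gamma(t)\cdot\nu(t)=0$ for all $t$. Put $\boldsymbol{\mu}(t)=J(\nu(t))$, where $J$ is anticlockwise rotation by $\pi/2$; the curvature of the Legendre curve is $(\ell,\beta)$ with $\ell=\dot\nu\cdot\boldsymbol{\mu}$, $\beta=\dot\gamma\cdot\boldsymbol{\mu}$. Thus, with $\gamma=(x,z)$, $\nu=(a,b)$: $\dot x=-\beta b$, $\dot z=\beta a$, $\dot a=-\ell b$, $\dot b=\ell a$, $a^2+b^2=1$. $\Delta=\{(\boldsymbol a,\boldsymbol b)\in S^2\times S^2\mid \boldsymbol a\cdot\boldsymbol b=0\}$. A framed surface is a smooth map $(\boldsymbol{X},\boldsymbol{n},\boldsymbol{s}):U\to\mathbb{R}^3\times\Delta$ with $\boldsymbol{X}_u\cdot\boldsymbol{n}=\boldsymbol{X}_v\cdot\boldsymbol{n}=0$ on $U$. With $\boldsymbol{t}=\boldsymbol{n}\times\boldsymbol{s}$, its basic invariants $(\mathcal{G},\mathcal{F}_1,\mathcal{F}_2)$ are the matrices of functions defined by $$\begin{pmatrix}\boldsymbol{X}_u\\ \boldsymbol{X}_v\end{pmatrix}=\mathcal{G}\begin{pmatrix}\boldsymbol{s}\\ \boldsymbol{t}\end{pmatrix},\quad \begin{pmatrix}\boldsymbol{n}_u\\ \boldsymbol{s}_u\\ \boldsymbol{t}_u\end{pmatrix}=\mathcal{F}_1\begin{pmatrix}\boldsymbol{n}\\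 \boldsymbol{s}\\ \boldsymbol{t}\end{pmatrix},\quad \begin{pmatrix}\boldsymbol{n}_v\\ \boldsymbol{s}_v\\ \boldsymbol{t}_v\end{pmatrix}=\mathcal{F}_2\begin{pmatrix}\boldsymbol{n}\\ \boldsymbol{s}\\ \boldsymbol{t}\end{pmatrix}.$$ Here $U=I\times[0,2\pi)$ and $(u,v)=(t,\theta)$. *)

theory Defs
  imports "HOL-Analysis.Analysis"
begin

text \<open>Class \<open>C\<^sup>k\<close> on an \<^emph>\<open>open\<close> set \<open>W\<close>: all iterated directional derivatives up to order \<open>k\<close>
  exist as Frechet derivatives, and those of order \<open>k\<close> are continuous (for finite-dimensional
  domains this is the usual notion).\<close>

primrec Ck_on :: "nat \<Rightarrow> 'a::real_normed_vector set \<Rightarrow> ('a \<Rightarrow> 'b::real_normed_vector) \<Rightarrow> bool" where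
  "Ck_on 0 W f \<longleftrightarrow> continuous_on W f"
| "Ck_on (Suc k) W f \<longleftrightarrow>
     (\<forall>p\<in>W. f differentiable (at p)) \<and>
     (\<forall>v. Ck_on k W (\<lambda>p. frechet_derivative f (at p) v))"

text \<open>The domains below (an interval \<open>I\<close> and \<open>I \<times> [0, 2\<pi>)\<close>) need not be open, so \<open>C\<^sup>\<infinity>\<close> on a set
  means, as usual, that near each point there is a \<open>C\<^sup>\<infinity>\<close> extension to an open neighbourhood.
  Only the values of \<open>f\<close> on \<open>S\<close> matter.\<close>

definition smooth_on :: "'a::real_normed_vector set \<Rightarrow> ('a \<Rightarrow> 'b::real_normed_vector) \<Rightarrow> bool" where
  "smooth_on S f \<longleftrightarrow>
     (\<forall>p\<in>S. \<exists>W g. open W \<and> p \<in> W \<and> (\<forall>k. Ck_on k W g) \<and> (\<forall>q\<in>W \<inter> S. g q = f q))"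

definition rot90 :: "real^2 \<Rightarrow> real^2" where
  "rot90 v = vector [- v$2, v$1]"

definition legendre_curve :: "real set \<Rightarrow> (real \<Rightarrow> real^2) \<Rightarrow> (real \<Rightarrow> real^2) \<Rightarrow> bool" where
  "legendre_curve I \<gamma> \<nu> \<longleftrightarrow>
     smooth_on I (\<lambda>t. (\<gamma> t, \<nu> t)) \<and>
     (\<forall>t\<in>I. \<nu> t \<in> sphere 0 1) \<and>
     (\<forall>t\<in>I. vector_derivative \<gamma> (at t within I) \<bullet> \<nu> t = 0)"

text \<open>The pair \<open>(\<ell>(t), \<beta>(t))\<close>. Derivatives are taken within \<open>I\<close>, hence one-sided at an endpoint
  belonging to \<open>I\<close>.\<close>

definition legendre_curvature ::
    "real set \<Rightarrow> (real \<Rightarrow> real^2) \<Rightarrow> (real \<Rightarrow> real^2) \<Rightarrow> real \<Rightarrow> real \<times> real" where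
  "legendre_curvature I \<gamma> \<nu> t =
     (vector_derivative \<nu> (at t within I) \<bullet> rot90 (\<nu> t),
      vector_derivative \<gamma> (at t within I) \<bullet> rot90 (\<nu> t))"

text \<open>Partial derivatives within a planar domain \<open>U\<close>: the other coordinate is frozen and the
  derivative is taken within the corresponding slice of \<open>U\<close>. They are meaningful when no slice has
  isolated points.\<close>

definition partial_u :: "(real \<times> real) set \<Rightarrow> (real \<times> real \<Rightarrow> real^3) \<Rightarrow> real \<times> real \<Rightarrow> real^3" where
  "partial_u U f = (\<lambda>(u, v). vector_derivative (\<lambda>w. f (w, v)) (at u within {w. (w, v) \<in> U}))"

definition partial_v :: "(real \<times> real) set \<Rightarrow> (real \<times> real \<Rightarrow> real^3) \<Rightarrow> real \<times> real \<Rightarrow> real^3" where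
  "partial_v U f = (\<lambda>(u, v). vector_derivative (\<lambda>w. f (u, w)) (at v within {w. (u, w) \<in> U}))"

definition Delta :: "((real^3) \<times> (real^3)) set" where
  "Delta = {(a, b). a \<in> sphere 0 1 \<and> b \<in> sphere 0 1 \<and> a \<bullet> b = 0}"

definition framed_surface ::
    "(real \<times> real) set \<Rightarrow> (real \<times> real \<Rightarrow> real^3) \<Rightarrow> (real \<times> real \<Rightarrow> real^3) \<Rightarrow>
     (real \<times> real \<Rightarrow> real^3) \<Rightarrow> bool" where
  "framed_surface U X n s \<longleftrightarrow>
     smooth_on U (\<lambda>p. (X p, n p, s p)) \<and>
     (\<forall>p\<in>U. (n p, s p) \<in> Delta) \<and>
     (\<forall>p\<in>U. partial_u U X p \<bullet> n p = 0 \<and> partial_v U X p \<bullet> n p = 0)"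

text \<open>The vectors in the defining relations are the rows of \<open>2 \<times> 3\<close> and \<open>3 \<times> 3\<close> matrices. For a
  framed surface the relations determine \<open>G\<close>, \<open>F\<^sub>1\<close>, \<open>F\<^sub>2\<close> uniquely on \<open>U\<close>, since \<open>n, s, t\<close> are
  orthonormal.\<close>

definition has_basic_invariants ::
    "(real \<times> real) set \<Rightarrow> (real \<times> real \<Rightarrow> real^3) \<Rightarrow> (real \<times> real \<Rightarrow> real^3) \<Rightarrow>
     (real \<times> real \<Rightarrow> real^3) \<Rightarrow> (real \<times> real \<Rightarrow> real^2^2) \<Rightarrow> (real \<times> real \<Rightarrow> real^3^3) \<Rightarrow>
     (real \<times> real \<Rightarrow> real^3^3) \<Rightarrow> bool" where
  "has_basic_invariants U X n s G F1 F2 \<longleftrightarrow>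
     (let t = (\<lambda>p. cross3 (n p) (s p)) in
      \<forall>p\<in>U.
        (vector [partial_u U X p, partial_v U X p] :: real^3^2) = G p ** vector [s p, t p] \<and>
        (vector [partial_u U n p, partial_u U s p, partial_u U t p] :: real^3^3) =
          F1 p ** vector [n p, s p, t p] \<and>
        (vector [partial_v U n p, partial_v U s p, partial_v U t p] :: real^3^3) =
          F2 p ** vector [n p, s p, t p])"

definition revolution_surface :: "(real \<Rightarrow> real) \<Rightarrow> (real \<Rightarrow> real) \<Rightarrow> real \<times> real \<Rightarrow> real^3" where
  "revolution_surface x z = (\<lambda>(t, \<theta>). vector [x t * cos \<theta>, x t * sin \<theta>, z t])"

definition revolution_normal :: "(real \<Rightarrow> real) \<Rightarrow> (real \<Rightarrow> real) \<Rightarrow> real \<times> real \<Rightarrow> real^3" where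
  "revolution_normal a b = (\<lambda>(t, \<theta>). vector [a t * cos \<theta>, a t * sin \<theta>, b t])"

definition revolution_tangent :: "real \<times> real \<Rightarrow> real^3" where
  "revolution_tangent = (\<lambda>(t, \<theta>). vector [sin \<theta>, - cos \<theta>, 0])"

end

theory Submission
  imports Defs
begin

text \<open>
  Everything reduces to planar data of the profile curve. The pair \<open>(\<nu>, rot90 \<nu>)\<close> is an
  orthonormal frame of the plane. Since \<open>\<gamma>'\<close> is orthogonal to \<open>\<nu>\<close>, it is the multiple
  \<open>\<beta> rot90 \<nu>\<close>; since \<open>\<nu>\<close> has unit length, so is \<open>\<nu>' = \<l> rot90 \<nu>\<close>
  (lemma \<open>legendre_curve_derivatives\<close>). The third frame vector of the surface is
  \<open>n \<times> s = (b cos \<theta>, b sin \<theta>, -a)\<close>, that is, minus the profile vector \<open>rot90 \<nu>\<close> rotated by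
  \<open>\<theta>\<close> about the axis. Hence the \<open>t\<close>-derivatives of the surface and of the frame are the
  rotated planar equations, while the \<open>\<theta>\<close>-derivatives come from the infinitesimal rotation
  about the axis; \<open>a\<^sup>2 + b\<^sup>2 = 1\<close> enters in \<open>s\<^sub>\<theta> = a n + b (n \<times> s)\<close>.

  Smoothness needs an actual extension. A local \<open>C\<^sup>\<infinity>\<close> extension of \<open>(\<gamma>, \<nu>)\<close> on \<open>W\<close> yields one
  of the surface and its frame on \<open>W \<times> \<real>\<close> by the same formulas, because the classes
  \<open>Ck_on k\<close> are stable under linear maps on either side and under bilinear products, and
  contain sine and cosine.
\<close>

section \<open>Calculus of the classes \<open>C\<^sup>k\<close>\<close>

lemma Ck_on_Suc_has_derivative:
  assumes "Ck_on (Suc k) W f" "p \<in> W"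
  shows "(f has_derivative frechet_derivative f (at p)) (at p)"
  using assms by (simp add: frechet_derivative_works)

lemma Ck_on_cong:
  assumes "open W" "Ck_on k W f" "\<And>p. p \<in> W \<Longrightarrow> f p = g p"
  shows "Ck_on k W g"
  using assms(2,3)
proof (induction k arbitrary: f g)
  case 0
  then show ?case
    by (metis Ck_on.simps(1) continuous_on_cong)
next
  case (Suc k)
  have der: "(g has_derivative frechet_derivative f (at p)) (at p)" if "p \<in> W" for p
    using has_derivative_transform_within_open[OF Ck_on_Suc_has_derivative[OF Suc.prems(1) that]
        assms(1) that] Suc.prems(2) by blast
  have "Ck_on k W (\<lambda>p. frechet_derivative g (at p) v)" for v
  proof (rule Suc.IH)
    show "Ck_on k W (\<lambda>p. frechet_derivative f (at p) v)"
      using Suc.prems(1) by simp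
    show "frechet_derivative f (at p) v = frechet_derivative g (at p) v" if "p \<in> W" for p
      using frechet_derivative_at[OF der[OF that]] by simp
  qed
  then show ?case
    using der by (auto simp: differentiable_def)
qed

text \<open>This replaces the chosen \<open>frechet_derivative\<close> by any explicit formula for the derivative;
  openness of \<open>W\<close> matters because the formula is known on \<open>W\<close> only.\<close>

lemma Ck_on_SucI:
  assumes "open W"
    and der: "\<And>p. p \<in> W \<Longrightarrow> (f has_derivative f' p) (at p)"
    and ck: "\<And>v. Ck_on k W (\<lambda>p. f' p v)"
  shows "Ck_on (Suc k) W f"
proof -
  have "Ck_on k W (\<lambda>p. frechet_derivative f (at p) v)" for v
    by (rule Ck_on_cong[OF assms(1) ck[of v]]) (simp add: frechet_derivative_at[OF der, symmetric])
  then show ?thesis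
    using der by (auto simp: differentiable_def)
qed

lemma Ck_on_Suc_imp:
  assumes "Ck_on (Suc k) W f"
  shows "Ck_on k W f"
  using assms
proof (induction k arbitrary: f)
  case 0
  then show ?case
    by (auto intro!: differentiable_imp_continuous_on
        simp: differentiable_on_def differentiable_at_withinI)
next
  case (Suc k)
  show ?case
    using Suc.prems Suc.IH by (subst Ck_on.simps(2)) auto
qed

lemma Ck_on_const:
  assumes "open W"
  shows "Ck_on k W (\<lambda>_. c)"
proof (induction k arbitrary: c)
  case (Suc k)
  show ?case
    by (rule Ck_on_SucI[OF assms has_derivative_const Suc.IH])
qed simp

lemma Ck_on_add:
  assumes "open W" "Ck_on k W f" "Ck_on k W g"
  shows "Ck_on k W (\<lambda>p. f p + g p)"
  using assms(2,3)
proof (induction k arbitrary: f g)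
  case 0
  then show ?case by (simp add: continuous_on_add)
next
  case (Suc k)
  show ?case
    by (rule Ck_on_SucI[OF assms(1) has_derivative_add[OF
            Ck_on_Suc_has_derivative[OF Suc.prems(1)] Ck_on_Suc_has_derivative[OF Suc.prems(2)]]])
      (use Suc in auto)
qed

lemma Ck_on_linear_image:
  assumes "open W" "bounded_linear L" "Ck_on k W f"
  shows "Ck_on k W (\<lambda>p. L (f p))"
  using assms(3)
proof (induction k arbitrary: f)
  case 0
  then show ?case
    using bounded_linear.continuous_on[OF assms(2)] by auto
next
  case (Suc k)
  show ?case
    by (rule Ck_on_SucI[OF assms(1) bounded_linear.has_derivative[OF assms(2)
            Ck_on_Suc_has_derivative[OF Suc.prems]]])
      (use Suc in auto)
qed

lemma Ck_on_compose_linear: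
  assumes "open V" "bounded_linear L" "\<And>p. p \<in> V \<Longrightarrow> L p \<in> W" "Ck_on k W f"
  shows "Ck_on k V (\<lambda>p. f (L p))"
  using assms(4)
proof (induction k arbitrary: f)
  case 0
  then show ?case
    using continuous_on_compose2[of W f V L] linear_continuous_on[OF assms(2)] assms(3)
    by auto
next
  case (Suc k)
  have "((\<lambda>p. f (L p)) has_derivative (\<lambda>v. frechet_derivative f (at (L p)) (L v))) (at p)"
    if "p \<in> V" for p
    using has_derivative_compose[OF bounded_linear_imp_has_derivative[OF assms(2)]
        Ck_on_Suc_has_derivative[OF Suc.prems assms(3)[OF that]]] .
  then show ?case
    by (rule Ck_on_SucI[OF assms(1)]) (use Suc in auto)
qed

lemma Ck_on_bilinear:
  assumes "open W" "bounded_bilinear B" "Ck_on k W f" "Ck_on k W g"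
  shows "Ck_on k W (\<lambda>p. B (f p) (g p))"
  using assms(3,4)
proof (induction k arbitrary: f g)
  case 0
  then show ?case
    using bounded_bilinear.continuous_on[OF assms(2)] by auto
next
  case (Suc k)
  have "Ck_on k W (\<lambda>p. B (f p) (frechet_derivative g (at p) v)
                       + B (frechet_derivative f (at p) v) (g p))" for v
    by (intro Ck_on_add Suc.IH assms(1) Ck_on_Suc_imp[OF Suc.prems(1)]
        Ck_on_Suc_imp[OF Suc.prems(2)]) (use Suc.prems in auto)
  then show ?case
    by (intro Ck_on_SucI[OF assms(1) bounded_bilinear.FDERIV[OF assms(2)
            Ck_on_Suc_has_derivative[OF Suc.prems(1)] Ck_on_Suc_has_derivative[OF Suc.prems(2)]]])
qed

text \<open>The four functions \<open>\<plusminus>sin\<close>, \<open>\<plusminus>cos\<close> are closed under differentiation; allowing an arbitrary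
  linear combination makes one induction serve for all of them.\<close>

lemma Ck_on_sin_cos:
  fixes c d :: real
  shows "Ck_on k UNIV (\<lambda>\<theta>. c * sin \<theta> + d * cos \<theta>)"
proof (induction k arbitrary: c d)
  case 0
  show ?case by (auto intro!: continuous_intros)
next
  case (Suc k)
  have "Ck_on k UNIV (\<lambda>\<theta>. (c * cos \<theta> - d * sin \<theta>) * v)" for v
    by (rule Ck_on_cong[OF open_UNIV Suc.IH[of "- d * v" "c * v"]]) (simp add: algebra_simps)
  moreover have "((\<lambda>\<theta>. c * sin \<theta> + d * cos \<theta>) has_derivative
                  (\<lambda>v. (c * cos \<theta> - d * sin \<theta>) * v)) (at \<theta>)" for \<theta>
    by (auto intro!: derivative_eq_intros simp: algebra_simps)
  ultimately show ?case
    by (intro Ck_on_SucI) auto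
qed

lemma Ck_on_Pair:
  fixes f :: "'a::real_normed_vector \<Rightarrow> 'b::real_normed_vector"
    and g :: "'a \<Rightarrow> 'c::real_normed_vector"
  assumes "open W" "Ck_on k W f" "Ck_on k W g"
  shows "Ck_on k W (\<lambda>p. (f p, g p))"
proof -
  have inj: "bounded_linear (\<lambda>y::'b. (y, 0::'c))" "bounded_linear (\<lambda>y::'c. (0::'b, y))"
    by (intro bounded_linear_Pair bounded_linear_ident bounded_linear_zero)+
  show ?thesis
    using Ck_on_add[OF assms(1) Ck_on_linear_image[OF assms(1) inj(1) assms(2)]
        Ck_on_linear_image[OF assms(1) inj(2) assms(3)]] by simp
qed

lemma vector_3_eq_sum:
  "(vector [p, q, r] :: real^3) =
     p *\<^sub>R vector [1, 0, 0] + q *\<^sub>R vector [0, 1, 0] + r *\<^sub>R vector [0, 0, 1]"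
  by (simp add: vec_eq_iff forall_3)

lemma Ck_on_vector_3:
  assumes "open W" "Ck_on k W f" "Ck_on k W g" "Ck_on k W h"
  shows "Ck_on k W (\<lambda>p. vector [f p, g p, h p] :: real^3)"
  by (subst vector_3_eq_sum, intro Ck_on_add assms(1)
      Ck_on_linear_image[OF assms(1) bounded_linear_scaleR_left assms(2)]
      Ck_on_linear_image[OF assms(1) bounded_linear_scaleR_left assms(3)]
      Ck_on_linear_image[OF assms(1) bounded_linear_scaleR_left assms(4)])

lemma smooth_on_imp_differentiable:
  assumes "smooth_on S f" "t \<in> S"
  shows "f differentiable (at t within S)"
proof -
  obtain W g where W: "open W" "t \<in> W" "\<And>k. Ck_on k W g" "\<And>q. q \<in> W \<inter> S \<Longrightarrow> g q = f q"
    using assms unfolding smooth_on_def by metis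
  have "(g has_derivative frechet_derivative g (at t)) (at t within S)"
    using Ck_on_Suc_has_derivative[OF W(3) W(2)] has_derivative_at_withinI by blast
  moreover have "\<forall>\<^sub>F q in at t within S. g q = f q"
    using W unfolding eventually_at_topological by blast
  ultimately have "(f has_derivative frechet_derivative g (at t)) (at t within S)"
    using has_derivative_transform_eventually W assms(2) by (metis IntI)
  then show ?thesis
    by (auto simp: differentiable_def)
qed

section \<open>Frame equations of a Legendre curve\<close>

text \<open>A connected set with more than one point has no isolated point. Hence one-sided derivatives
  within the slices of the domain, endpoints included, are unique.\<close>

lemma at_within_interval_nontrivial:
  fixes I :: "real set"
  assumes "is_interval I" "interior I \<noteq> {}" "t \<in> I"
  shows "at t within I \<noteq> bot"
proof -
  have "I \<noteq> {c}" for c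
    using assms(2) by auto
  then have "t islimpt I"
    using connected_imp_perfect assms(1,3) is_interval_connected by blast
  then show ?thesis
    by (simp add: trivial_limit_within)
qed

lemma legendre_curve_derivatives:
  assumes I: "is_interval I" "interior I \<noteq> {}"
    and leg: "legendre_curve I \<gamma> \<nu>"
    and "t \<in> I" and curv: "legendre_curvature I \<gamma> \<nu> t = (l, \<beta>)"
  shows "(\<gamma> has_vector_derivative \<beta> *\<^sub>R rot90 (\<nu> t)) (at t within I)"
    and "(\<nu> has_vector_derivative l *\<^sub>R rot90 (\<nu> t)) (at t within I)"
proof -
  let ?F = "at t within I"
  define g' where "g' = vector_derivative \<gamma> ?F"
  define n' where "n' = vector_derivative \<nu> ?F"
  have nontriv: "?F \<noteq> bot"
    using at_within_interval_nontrivial I \<open>t \<in> I\<close> .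
  have diff: "(\<lambda>t. (\<gamma> t, \<nu> t)) differentiable ?F"
    using leg \<open>t \<in> I\<close> smooth_on_imp_differentiable unfolding legendre_curve_def by blast
  have g: "(\<gamma> has_vector_derivative g') ?F"
    using differentiable_compose[OF bounded_linear_imp_differentiable[OF bounded_linear_fst] diff]
    by (simp add: g'_def vector_derivative_works)
  have n: "(\<nu> has_vector_derivative n') ?F"
    using differentiable_compose[OF bounded_linear_imp_differentiable[OF bounded_linear_snd] diff]
    by (simp add: n'_def vector_derivative_works)
  have unit: "\<nu> s \<bullet> \<nu> s = 1" if "s \<in> I" for s
    using leg that by (auto simp: legendre_curve_def dot_square_norm)
  \<comment> \<open>Any vector is recovered from its components in the orthonormal frame \<open>(\<nu>, rot90 \<nu>)\<close>.\<close>
  have expand: "w = (w \<bullet> rot90 (\<nu> t)) *\<^sub>R rot90 (\<nu> t)" if "w \<bullet> \<nu> t = 0" for w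
  proof -
    define a where "a = \<nu> t $ 1"
    define b where "b = \<nu> t $ 2"
    have ab: "a * a + b * b = 1" and w: "w $ 1 * a + w $ 2 * b = 0"
      using unit[OF \<open>t \<in> I\<close>] that by (simp_all add: inner_vec_def sum_2 a_def b_def)
    have "w $ 1 = (w $ 1 * - b + w $ 2 * a) * - b" "w $ 2 = (w $ 1 * - b + w $ 2 * a) * a"
      using ab w by algebra+
    then show ?thesis
      by (simp add: vec_eq_iff forall_2 inner_vec_def sum_2 rot90_def a_def b_def)
  qed
  have "g' \<bullet> \<nu> t = 0"
    using leg \<open>t \<in> I\<close> by (simp add: legendre_curve_def g'_def)
  moreover have "g' \<bullet> rot90 (\<nu> t) = \<beta>"
    using curv by (simp add: legendre_curvature_def g'_def)
  ultimately show "(\<gamma> has_vector_derivative \<beta> *\<^sub>R rot90 (\<nu> t)) ?F"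
    using expand g by metis
  have "((\<lambda>s. \<nu> s \<bullet> \<nu> s) has_vector_derivative \<nu> t \<bullet> n' + n' \<bullet> \<nu> t) ?F"
    using bounded_bilinear.has_vector_derivative[OF bounded_bilinear_inner n n] .
  moreover have "((\<lambda>s. \<nu> s \<bullet> \<nu> s) has_vector_derivative 0) ?F"
    by (rule has_vector_derivative_transform[OF \<open>t \<in> I\<close> _ has_vector_derivative_const[of 1]])
      (simp add: unit)
  ultimately have "\<nu> t \<bullet> n' + n' \<bullet> \<nu> t = 0"
    using vector_derivative_unique_within[OF nontriv] by blast
  then have "n' \<bullet> \<nu> t = 0"
    by (simp add: inner_commute)
  moreover have "n' \<bullet> rot90 (\<nu> t) = l"
    using curv by (simp add: legendre_curvature_def n'_def)
  ultimately show "(\<nu> has_vector_derivative l *\<^sub>R rot90 (\<nu> t)) ?F"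
    using expand n by metis
qed

section \<open>The surface of revolution\<close>

lemma has_vector_derivative_vector_3:
  assumes "(f has_real_derivative f') F" "(g has_real_derivative g') F"
    "(h has_real_derivative h') F"
  shows "((\<lambda>w. vector [f w, g w, h w] :: real^3) has_vector_derivative vector [f', g', h']) F"
  unfolding vector_3_eq_sum[of "f _"] vector_3_eq_sum[of f']
  by (intro has_vector_derivative_add
      bounded_linear.has_vector_derivative[OF bounded_linear_scaleR_left])
    (use assms in \<open>simp_all add: has_real_derivative_iff_has_vector_derivative\<close>)

lemma partial_revolution_frame:
  assumes "t \<in> I" "\<theta> \<in> {0..<2*pi}" "at t within I \<noteq> bot"
    and "(p has_real_derivative p') (at t within I)" "(q has_real_derivative q') (at t within I)"
  shows "partial_u (I \<times> {0..<2*pi}) (revolution_normal p q) (t, \<theta>) =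
           vector [p' * cos \<theta>, p' * sin \<theta>, q']"
    and "partial_v (I \<times> {0..<2*pi}) (revolution_normal p q) (t, \<theta>) =
           vector [- (p t * sin \<theta>), p t * cos \<theta>, 0]"
    and "partial_u (I \<times> {0..<2*pi}) revolution_tangent (t, \<theta>) = 0"
    and "partial_v (I \<times> {0..<2*pi}) revolution_tangent (t, \<theta>) = vector [cos \<theta>, sin \<theta>, 0]"
proof -
  have slices: "{w. (w, \<theta>) \<in> I \<times> {0..<2*pi}} = I" "{w. (t, w) \<in> I \<times> {0..<2*pi}} = {0..<2*pi}"
    using assms(1,2) by auto
  have angle: "at \<theta> within {0..<2*pi} \<noteq> bot"
    by (rule at_within_interval_nontrivial) (use assms(2) in \<open>auto simp: is_interval_co\<close>)
  have "((\<lambda>w. vector [p w * cos \<theta>, p w * sin \<theta>, q w] :: real^3) has_vector_derivative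
          vector [p' * cos \<theta>, p' * sin \<theta>, q']) (at t within I)"
    using assms(4,5) by (intro has_vector_derivative_vector_3 DERIV_cmult_right)
  then show "partial_u (I \<times> {0..<2*pi}) (revolution_normal p q) (t, \<theta>) =
           vector [p' * cos \<theta>, p' * sin \<theta>, q']"
    using vector_derivative_within[OF assms(3)]
    by (simp add: partial_u_def revolution_normal_def slices del: mem_Sigma_iff)
  have "((\<lambda>w. vector [p t * cos w, p t * sin w, q t] :: real^3) has_vector_derivative
          vector [- (p t * sin \<theta>), p t * cos \<theta>, 0]) (at \<theta> within {0..<2*pi})"
    by (intro has_vector_derivative_vector_3) (auto intro!: derivative_eq_intros)
  then show "partial_v (I \<times> {0..<2*pi}) (revolution_normal p q) (t, \<theta>) =
           vector [- (p t * sin \<theta>), p t * cos \<theta>, 0]"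
    using vector_derivative_within[OF angle]
    by (simp add: partial_v_def revolution_normal_def slices del: mem_Sigma_iff)
  show "partial_u (I \<times> {0..<2*pi}) revolution_tangent (t, \<theta>) = 0"
    using vector_derivative_within[OF assms(3) has_vector_derivative_const]
    by (simp add: partial_u_def revolution_tangent_def slices del: mem_Sigma_iff)
  have "((\<lambda>w. vector [sin w, - cos w, 0] :: real^3) has_vector_derivative
          vector [cos \<theta>, sin \<theta>, 0]) (at \<theta> within {0..<2*pi})"
    by (intro has_vector_derivative_vector_3) (auto intro!: derivative_eq_intros)
  then show "partial_v (I \<times> {0..<2*pi}) revolution_tangent (t, \<theta>) = vector [cos \<theta>, sin \<theta>, 0]"
    using vector_derivative_within[OF angle]
    by (simp add: partial_v_def revolution_tangent_def slices del: mem_Sigma_iff)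
qed

text \<open>The surface itself and the third frame vector are given by the same formula as the normal,
  with other profile functions, so the partial derivatives need to be computed only once.\<close>

lemma revolution_surface_eq_normal: "revolution_surface x z = revolution_normal x z"
  by (simp add: revolution_surface_def revolution_normal_def)

lemma cross3_revolution_frame:
  "(\<lambda>p. cross3 (revolution_normal a b p) (revolution_tangent p)) =
     revolution_normal b (\<lambda>t. - a t)"
proof -
  have "- (a t * cos \<theta> * cos \<theta>) - a t * sin \<theta> * sin \<theta> = - a t" for t \<theta>
    using sin_cos_squared_add[of \<theta>] by algebra
  then show ?thesis
    by (auto simp: fun_eq_iff revolution_normal_def revolution_tangent_def cross3_def
        vec_eq_iff forall_3)
qed

lemma smooth_on_revolution:
  assumes "smooth_on I (\<lambda>t. (\<gamma> t, \<nu> t))"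
    and \<gamma>: "\<And>t. t \<in> I \<Longrightarrow> \<gamma> t = (vector [x t, z t] :: real^2)"
    and \<nu>: "\<And>t. t \<in> I \<Longrightarrow> \<nu> t = (vector [a t, b t] :: real^2)"
  shows "smooth_on (I \<times> T)
           (\<lambda>p. (revolution_surface x z p, revolution_normal a b p, revolution_tangent p))"
  unfolding smooth_on_def
proof
  fix p
  assume "p \<in> I \<times> T"
  then have "fst p \<in> I" by auto
  then obtain W g where W: "open W" "fst p \<in> W" "\<And>k. Ck_on k W g"
      "\<And>q. q \<in> W \<inter> I \<Longrightarrow> g q = (\<gamma> q, \<nu> q)"
    using assms(1) unfolding smooth_on_def by metis
  define V where "V = W \<times> (UNIV :: real set)"
  have V: "open V" "p \<in> V"
    using W by (auto simp: V_def open_Times mem_Times_iff)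
  define gx where "gx = (\<lambda>t. fst (g t) $ 1)"
  define gz where "gz = (\<lambda>t. fst (g t) $ 2)"
  define ga where "ga = (\<lambda>t. snd (g t) $ 1)"
  define gb where "gb = (\<lambda>t. snd (g t) $ 2)"
  have comp: "Ck_on k V (\<lambda>p. L (g (fst p)))" if "bounded_linear L" for k and L :: "_ \<Rightarrow> real"
    by (rule Ck_on_linear_image[OF V(1) that])
      (rule Ck_on_compose_linear[OF V(1) bounded_linear_fst _ W(3)], auto simp: V_def)
  have profile: "Ck_on k V (\<lambda>p. gx (fst p))" "Ck_on k V (\<lambda>p. gz (fst p))"
      "Ck_on k V (\<lambda>p. ga (fst p))" "Ck_on k V (\<lambda>p. gb (fst p))" for k
    unfolding gx_def gz_def ga_def gb_def
    by (intro comp bounded_linear_compose[OF bounded_linear_vec_nth]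
        bounded_linear_fst bounded_linear_snd)+
  have angle: "Ck_on k V (\<lambda>p. c * sin (snd p) + d * cos (snd p))" for k c d
    by (rule Ck_on_compose_linear[OF V(1) bounded_linear_snd _ Ck_on_sin_cos]) simp
  have trig: "Ck_on k V (\<lambda>p. sin (snd p))" "Ck_on k V (\<lambda>p. cos (snd p))"
      "Ck_on k V (\<lambda>p. - cos (snd p))" for k
    using angle[of k 1 0] angle[of k 0 1] angle[of k 0 "- 1"] by simp_all
  let ?G = "\<lambda>p. (vector [gx (fst p) * cos (snd p), gx (fst p) * sin (snd p), gz (fst p)] :: real^3,
                 vector [ga (fst p) * cos (snd p), ga (fst p) * sin (snd p), gb (fst p)] :: real^3,
                 vector [sin (snd p), - cos (snd p), 0] :: real^3)"
  have "Ck_on k V ?G" for k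
    by (intro Ck_on_Pair Ck_on_vector_3 Ck_on_const V(1) profile trig
        Ck_on_bilinear[OF V(1) bounded_bilinear_mult])
  moreover have "?G q = (revolution_surface x z q, revolution_normal a b q, revolution_tangent q)"
    if "q \<in> V \<inter> (I \<times> T)" for q
    using that W(4)[of "fst q"] \<gamma>[of "fst q"] \<nu>[of "fst q"]
    by (auto simp: V_def gx_def gz_def ga_def gb_def revolution_surface_def
        revolution_normal_def revolution_tangent_def)
  ultimately show "\<exists>W g. open W \<and> p \<in> W \<and> (\<forall>k. Ck_on k W g) \<and> (\<forall>q\<in>W \<inter> I \<times> T.
      g q = (revolution_surface x z q, revolution_normal a b q, revolution_tangent q))"
    using V by blast
qed

theorem proposition3p2:
  fixes I :: "real set"
    and \<gamma> \<nu> :: "real \<Rightarrow> real^2"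
    and x z a b \<l> \<beta> :: "real \<Rightarrow> real"
  assumes "is_interval I" and "interior I \<noteq> {}"
    and "legendre_curve I \<gamma> \<nu>"
    and "\<And>t. t \<in> I \<Longrightarrow> legendre_curvature I \<gamma> \<nu> t = (\<l> t, \<beta> t)"
    and "\<And>t. t \<in> I \<Longrightarrow> \<gamma> t = vector [x t, z t]"
    and "\<And>t. t \<in> I \<Longrightarrow> \<nu> t = vector [a t, b t]"
  shows "framed_surface (I \<times> {0..<2*pi})
           (revolution_surface x z) (revolution_normal a b) revolution_tangent
       \<and> has_basic_invariants (I \<times> {0..<2*pi})
           (revolution_surface x z) (revolution_normal a b) revolution_tangent
           (\<lambda>(t, \<theta>). vector [vector [0, - \<beta> t],
                              vector [- x t, 0]])
           (\<lambda>(t, \<theta>). vector [vector [0, 0, - \<l> t],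
                              vector [0, 0, 0],
                              vector [\<l> t, 0, 0]])
           (\<lambda>(t, \<theta>). vector [vector [0, - a t, 0],
                              vector [a t, 0, b t],
                              vector [0, - b t, 0]])"
proof -
  let ?U = "I \<times> {0..<2*pi}"
  have nontriv: "at t within I \<noteq> bot" if "t \<in> I" for t
    using at_within_interval_nontrivial[OF assms(1,2) that] .
  have unit: "a t * a t + b t * b t = 1" if "t \<in> I" for t
  proof -
    have "\<nu> t \<bullet> \<nu> t = 1"
      using assms(3) that by (auto simp: legendre_curve_def dot_square_norm)
    then show ?thesis
      by (simp add: assms(6)[OF that] inner_vec_def sum_2)
  qed
  have coord: "(f has_real_derivative d $ i) (at t within I)"
    if "(h has_vector_derivative d) (at t within I)" "t \<in> I" "\<And>s. s \<in> I \<Longrightarrow> f s = h s $ i"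
    for f and h :: "real \<Rightarrow> real^2" and d i t
    unfolding has_real_derivative_iff_has_vector_derivative
    by (rule has_vector_derivative_transform[OF that(2) that(3)
          bounded_linear.has_vector_derivative[OF bounded_linear_vec_nth that(1)]])
  have dx: "(x has_real_derivative - (\<beta> t * b t)) (at t within I)"
    and dz: "(z has_real_derivative \<beta> t * a t) (at t within I)"
    and da: "(a has_real_derivative - (\<l> t * b t)) (at t within I)"
    and db: "(b has_real_derivative \<l> t * a t) (at t within I)" if t: "t \<in> I" for t
  proof -
    note ders = legendre_curve_derivatives[OF assms(1-3) t assms(4)[OF t]]
    show "(x has_real_derivative - (\<beta> t * b t)) (at t within I)"
      using coord[OF ders(1) t, of x 1] by (simp add: assms(5,6) t rot90_def)
    show "(z has_real_derivative \<beta> t * a t) (at t within I)"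
      using coord[OF ders(1) t, of z 2] by (simp add: assms(5,6) t rot90_def)
    show "(a has_real_derivative - (\<l> t * b t)) (at t within I)"
      using coord[OF ders(2) t, of a 1] by (simp add: assms(5,6) t rot90_def)
    show "(b has_real_derivative \<l> t * a t) (at t within I)"
      using coord[OF ders(2) t, of b 2] by (simp add: assms(5,6) t rot90_def)
  qed
  note partials = partial_revolution_frame[OF _ _ nontriv]
  have circle: "sin \<theta> * sin \<theta> + cos \<theta> * cos \<theta> = 1" for \<theta> :: real
    using sin_cos_squared_add[of \<theta>] by (simp add: power2_eq_square)
  have rot: "a t * cos \<theta> * (a t * cos \<theta>) + a t * sin \<theta> * (a t * sin \<theta>) + b t * b t = 1"
    if "t \<in> I" for t \<theta>
    using unit[OF that] circle[of \<theta>] by algebra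
  have frame: "(revolution_normal a b (t, \<theta>), revolution_tangent (t, \<theta>)) \<in> Delta"
    if "t \<in> I" for t \<theta>
    using rot[OF that, of \<theta>] circle[of \<theta>]
    by (simp add: Delta_def revolution_normal_def revolution_tangent_def norm_eq_1
        inner_vec_def sum_3 algebra_simps)
  have tangent:
    "partial_u ?U (revolution_surface x z) (t, \<theta>) \<bullet> revolution_normal a b (t, \<theta>) = 0"
    "partial_v ?U (revolution_surface x z) (t, \<theta>) \<bullet> revolution_normal a b (t, \<theta>) = 0"
    if t: "t \<in> I" "\<theta> \<in> {0..<2*pi}" for t \<theta>
  proof -
    have "- (\<beta> t * b t) * cos \<theta> * (a t * cos \<theta>) + - (\<beta> t * b t) * sin \<theta> * (a t * sin \<theta>)
            + \<beta> t * a t * b t = 0"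
      using circle[of \<theta>] by algebra
    then show "partial_u ?U (revolution_surface x z) (t, \<theta>) \<bullet> revolution_normal a b (t, \<theta>) = 0"
      unfolding revolution_surface_eq_normal partials(1)[OF t t(1) dx[OF t(1)] dz[OF t(1)]]
      by (simp add: revolution_normal_def inner_vec_def sum_3)
    show "partial_v ?U (revolution_surface x z) (t, \<theta>) \<bullet> revolution_normal a b (t, \<theta>) = 0"
      unfolding revolution_surface_eq_normal partials(2)[OF t t(1) dx[OF t(1)] dz[OF t(1)]]
      by (simp add: revolution_normal_def inner_vec_def sum_3)
  qed
  have "framed_surface ?U (revolution_surface x z) (revolution_normal a b) revolution_tangent"
    unfolding framed_surface_def
    using smooth_on_revolution[OF _ assms(5,6)] assms(3) frame tangent
    by (auto simp: legendre_curve_def)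
  moreover have "has_basic_invariants ?U
           (revolution_surface x z) (revolution_normal a b) revolution_tangent
           (\<lambda>(t, \<theta>). vector [vector [0, - \<beta> t],
                              vector [- x t, 0]])
           (\<lambda>(t, \<theta>). vector [vector [0, 0, - \<l> t],
                              vector [0, 0, 0],
                              vector [\<l> t, 0, 0]])
           (\<lambda>(t, \<theta>). vector [vector [0, - a t, 0],
                              vector [a t, 0, b t],
                              vector [0, - b t, 0]])"
    unfolding has_basic_invariants_def Let_def
      cross3_revolution_frame[THEN fun_cong] revolution_surface_eq_normal
  proof (intro ballI, clarify, intro conjI)
    fix t \<theta>
    assume t: "t \<in> I" and \<theta>: "\<theta> \<in> {0..<2*pi}"
    note dX = partials[OF t \<theta> t dx[OF t] dz[OF t]]
    note dn = partials[OF t \<theta> t da[OF t] db[OF t]]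
    note dt = partials[OF t \<theta> t db[OF t] DERIV_minus[OF da[OF t]]]
    note matrix = matrix_matrix_mult_def vec_eq_iff forall_2 forall_3 sum_2 sum_3
      revolution_normal_def revolution_tangent_def
    show "vector [partial_u ?U (revolution_normal x z) (t, \<theta>),
                  partial_v ?U (revolution_normal x z) (t, \<theta>)] =
          (vector [vector [0, - \<beta> t], vector [- x t, 0]] :: real^2^2) **
          vector [revolution_tangent (t, \<theta>), revolution_normal b (\<lambda>t. - a t) (t, \<theta>)]"
      unfolding dX by (simp add: matrix)
    show "vector [partial_u ?U (revolution_normal a b) (t, \<theta>),
                  partial_u ?U revolution_tangent (t, \<theta>),
                  partial_u ?U (revolution_normal b (\<lambda>t. - a t)) (t, \<theta>)] =
          (vector [vector [0, 0, - \<l> t], vector [0, 0, 0], vector [\<l> t, 0, 0]] :: real^3^3) **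
          vector [revolution_normal a b (t, \<theta>), revolution_tangent (t, \<theta>),
                  revolution_normal b (\<lambda>t. - a t) (t, \<theta>)]"
      unfolding dn dt by (simp add: matrix)
    \<comment> \<open>The horizontal coordinates of \<open>s\<^sub>\<theta> = a n + b (n \<times> s)\<close>, which use \<open>a\<^sup>2 + b\<^sup>2 = 1\<close>.\<close>
    have "cos \<theta> = a t * (a t * cos \<theta>) + b t * (b t * cos \<theta>)"
      "sin \<theta> = a t * (a t * sin \<theta>) + b t * (b t * sin \<theta>)"
      using unit[OF t] by algebra+
    then show "vector [partial_v ?U (revolution_normal a b) (t, \<theta>),
                  partial_v ?U revolution_tangent (t, \<theta>),
                  partial_v ?U (revolution_normal b (\<lambda>t. - a t)) (t, \<theta>)] =
          (vector [vector [0, - a t, 0], vector [a t, 0, b t], vector [0, - b t, 0]] :: real^3^3) **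
          vector [revolution_normal a b (t, \<theta>), revolution_tangent (t, \<theta>),
                  revolution_normal b (\<lambda>t. - a t) (t, \<theta>)]"
      unfolding dn dt by (simp add: matrix)
  qed
  ultimately show ?thesis by blast
qed

end
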